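(* Let $a$, $b$, $c$ be positive integers with $\gcd(a,b)=\gcd(b,c)=\gcd(c,a)=1$. Put $\alpha=\frac{a+b+c}{2}$, $\beta=2abc$, and $$M=\left\lfloor \frac{(2\alpha\beta-1)^2-4\alpha^2}{4\beta}+\alpha\right\rfloor+1.$$ For a natural number $k$ define $$\gamma_k=\left\lfloor \sqrt{\beta(k+\alpha)+\alpha^2}-\alpha\right\rfloor,\qquad \delta_k=\left\lfloor \sqrt{\beta(k-\alpha)+\alpha^2}-\alpha\right\rfloor.$$ Let $R_k(a,b,c)$ be the set of all integers $n$ such that the equation $ax+by+cz=n$ has exactly $k$ solutions $(x,y,z)$ in nonnegative integers. Suppose $k\ge M$. If $\gamma_k=\delta_k$, then $R_k(a,b,c)=\emptyset$. If $\gamma_k\neq\delta_k$, then $R_k(a,b,c)=\{\gamma_k\}$ when the equation $ax+by+cz=\gamma_k$ has exactly $k$ solutions in nonnegative integers, and $R_k(a,b,c)=\emptyset$ otherwise. *)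

theory Defs
  imports Complex_Main
begin

definition alpha :: "nat \<Rightarrow> nat \<Rightarrow> nat \<Rightarrow> real" where
  "alpha a b c = (real a + real b + real c) / 2"

definition beta :: "nat \<Rightarrow> nat \<Rightarrow> nat \<Rightarrow> real" where
  "beta a b c = 2 * real a * real b * real c"

definition bound_M :: "nat \<Rightarrow> nat \<Rightarrow> nat \<Rightarrow> int" where
  "bound_M a b c =
    \<lfloor>((2 * alpha a b c * beta a b c - 1)\<^sup>2 - 4 * (alpha a b c)\<^sup>2) / (4 * beta a b c)
       + alpha a b c\<rfloor> + 1"

(* Isabelle's sqrt is total (sqrt x < 0 for x < 0).  The radicand of delta can only be negative
   for small k; it is nonnegative for every k with int k >= bound_M a b c. *)

definition gamma :: "nat \<Rightarrow> nat \<Rightarrow> nat \<Rightarrow> nat \<Rightarrow> int" where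
  "gamma a b c k =
    \<lfloor>sqrt (beta a b c * (real k + alpha a b c) + (alpha a b c)\<^sup>2) - alpha a b c\<rfloor>"

definition delta :: "nat \<Rightarrow> nat \<Rightarrow> nat \<Rightarrow> nat \<Rightarrow> int" where
  "delta a b c k =
    \<lfloor>sqrt (beta a b c * (real k - alpha a b c) + (alpha a b c)\<^sup>2) - alpha a b c\<rfloor>"

definition solutions :: "nat \<Rightarrow> nat \<Rightarrow> nat \<Rightarrow> int \<Rightarrow> (nat \<times> nat \<times> nat) set" where
  "solutions a b c n = {(x, y, z). int a * int x + int b * int y + int c * int z = n}"

(* The finiteness conjunct is needed because card is 0 on infinite sets. *)
definition has_exactly_solutions :: "nat \<Rightarrow> nat \<Rightarrow> nat \<Rightarrow> int \<Rightarrow> nat \<Rightarrow> bool" where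
  "has_exactly_solutions a b c n k \<longleftrightarrow>
    finite (solutions a b c n) \<and> card (solutions a b c n) = k"

definition R :: "nat \<Rightarrow> nat \<Rightarrow> nat \<Rightarrow> nat \<Rightarrow> int set" where
  "R k a b c = {n. has_exactly_solutions a b c n k}"

end

theory Submission
  imports Defs
begin

text \<open>
  Write \<open>N(n)\<close> for the number of solutions and \<open>p(n) = n (n + a + b + c) / (2abc)\<close>.
  For fixed \<open>z\<close> the equation \<open>a x + b y = m\<close> with \<open>m = n - c z\<close> has
  \<open>m/(ab) + 1 - ((u m) mod b)/b - ((v m) mod a)/a\<close> solutions, where \<open>u a + v b = 1\<close>.
  Summing over \<open>0 \<le> z \<le> n div c\<close>, the two remainders run through arithmetic progressions with
  steps prime to the moduli, so full periods average out and only an incomplete period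
  contributes an error. This gives \<open>|N(n) - p(n)| < \<alpha>\<close>.
  Hence \<open>N(n) = k\<close> confines \<open>n\<close> to an open interval with end points
  \<open>sqrt (\<beta> (k \<plusminus> \<alpha>) + \<alpha>\<^sup>2) - \<alpha>\<close>, whose length is less than 1 as soon as \<open>k \<ge> M\<close>.
\<close>

section \<open>Two variables\<close>

text \<open>The pair \<open>(u * m, v * m)\<close> solves the equation over the integers. Reducing
  its entries modulo \<open>b\<close> and \<open>a\<close> to \<open>x0\<close> and
  \<open>y0\<close> leaves m = a b t + a x0 + b y0, and the nonnegative solutions are (x0 + b i, y0
  + a (t - i)) with 0 \<le> i \<le> t. Hence there are t + 1 of them, and solving for t gives the
  formula.\<close>

lemma card_two_var_solutions:
  fixes a b :: nat and u v m :: int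
  assumes pos: "a > 0" "b > 0" and uv: "u * int a + v * int b = 1" and m: "m \<ge> 0"
  defines "S \<equiv> {(x :: nat, y :: nat). int a * int x + int b * int y = m}"
  shows "finite S"
    and "real (card S) = real_of_int m / (real a * real b) + 1
           - real_of_int ((u * m) mod int b) / real b
           - real_of_int ((v * m) mod int a) / real a"
proof -
  define x0 where "x0 = (u * m) mod int b"
  define y0 where "y0 = (v * m) mod int a"
  define t where "t = (u * m) div int b + (v * m) div int a"
  have x0: "0 \<le> x0" "x0 < int b" and y0: "0 \<le> y0" "y0 < int a"
    using pos by (auto simp: x0_def y0_def)
  have um: "u * m = int b * ((u * m) div int b) + x0" and vm: "v * m = int a * ((v * m) div int a) + y0"
    by (auto simp: x0_def y0_def)
  have "m = int a * (u * m) + int b * (v * m)"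
    using arg_cong[OF uv, of "\<lambda>w. w * m"] by (simp add: algebra_simps)
  also have "\<dots> = int a * int b * t + int a * x0 + int b * y0"
    by (subst um, subst vm) (simp add: t_def algebra_simps)
  finally have m_eq: "m = int a * int b * t + int a * x0 + int b * y0" .
  \<comment> \<open>This lets \<open>nat (t + 1)\<close> become t + 1 over the reals: the formula
    stays exact in the case t = -1 of no solutions. A value t \<le> -2 would force m < 0, because a
    x0 + b y0 < 2 a b.\<close>
  have t: "t \<ge> -1"
  proof (rule ccontr)
    assume "\<not> t \<ge> -1"
    then have "int a * int b * t \<le> int a * int b * (-2)"
      by (intro mult_left_mono) auto
    moreover have "int a * x0 < int a * int b" "int b * y0 < int b * int a"
      using x0 y0 pos by simp_all
    ultimately have "m < 0"
      unfolding m_eq by (simp add: mult.commute[of "int b" "int a"])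
    with m show False by simp
  qed
  define f where "f = (\<lambda>i :: int. (nat (x0 + int b * i), nat (y0 + int a * (t - i))))"
  have "bij_betw f {0..t} S"
  proof (rule bij_betwI')
    fix i j assume "i \<in> {0..t}" "j \<in> {0..t}"
    then show "f i = f j \<longleftrightarrow> i = j"
      using x0 pos by (auto simp: f_def nat_eq_iff)
  next
    fix i assume i: "i \<in> {0..t}"
    then have "0 \<le> x0 + int b * i" "0 \<le> y0 + int a * (t - i)"
      using x0 y0 by auto
    then show "f i \<in> S"
      by (simp add: f_def S_def m_eq algebra_simps)
  next
    fix s assume "s \<in> S"
    then obtain x y where s: "s = (x, y)" and xy: "int a * int x + int b * int y = m"
      by (auto simp: S_def)
    \<comment> \<open>\<open>w\<close> is the parameter of the general integer solution: (x, y) = (u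
      m + b w, v m - a w).\<close>
    define w where "w = v * int x - u * int y"
    have "int x = (u * int a + v * int b) * int x" by (simp add: uv)
    also have "\<dots> = u * m + int b * w"
      unfolding w_def xy[symmetric] by (simp add: algebra_simps)
    finally have x: "int x = x0 + int b * ((u * m) div int b + w)"
      using um by (simp add: algebra_simps)
    have "int y = (u * int a + v * int b) * int y" by (simp add: uv)
    also have "\<dots> = v * m - int a * w"
      unfolding w_def xy[symmetric] by (simp add: algebra_simps)
    finally have y: "int y = y0 + int a * ((v * m) div int a - w)"
      using vm by (simp add: algebra_simps)
    define i where "i = (u * m) div int b + w"
    have xi: "int x = x0 + int b * i" and yi: "int y = y0 + int a * (t - i)"
      using x y by (simp_all add: i_def t_def)
    \<comment> \<open>Since 0 \<le> x0 < b and 0 \<le> y0 < a, both parameters are quotients, so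
      they inherit nonnegativity from x and y.\<close>
    have "i = int x div int b" "t - i = int y div int a"
      unfolding xi yi using x0 y0 by (simp_all add: div_pos_pos_trivial)
    then have "0 \<le> i" "0 \<le> t - i"
      using pos by (simp_all add: pos_imp_zdiv_nonneg_iff)
    moreover have "s = f i"
      by (simp add: s f_def xi[symmetric] yi[symmetric])
    ultimately show "\<exists>i\<in>{0..t}. s = f i" by auto
  qed
  then show "finite S"
    using bij_betw_finite by auto
  have "card S = nat (t + 1)"
    using bij_betw_same_card[OF \<open>bij_betw f {0..t} S\<close>] by simp
  then have "real (card S) = real_of_int t + 1"
    using t by simp
  moreover have "real_of_int m = real a * real b * real_of_int t + real a * real_of_int x0 + real b * real_of_int y0"
    using arg_cong[OF m_eq, of real_of_int] by simp
  ultimately show "real (card S) = real_of_int m / (real a * real b) + 1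
           - real_of_int ((u * m) mod int b) / real b - real_of_int ((v * m) mod int a) / real a"
    unfolding x0_def[symmetric] y0_def[symmetric] using pos by (simp add: field_simps)
qed

section \<open>Remainders along an arithmetic progression\<close>

text \<open>As \<open>v\<close> is invertible modulo \<open>b\<close>, any \<open>b\<close>
  consecutive terms hit each residue exactly once, so the sum is 0 + 1 + ... + (b - 1).\<close>

lemma sum_mod_full_period:
  fixes u v :: int and b s :: nat
  assumes b: "b > 0" and cop: "coprime v (int b)"
  shows "(\<Sum>z = s..<s + b. real_of_int ((u + v * int z) mod int b)) = real b * (real b - 1) / 2"
proof -
  let ?g = "\<lambda>z::nat. (u + v * int z) mod int b"
  have inj: "inj_on ?g {s..<s + b}"
  proof (rule inj_onI)
    fix i j assume ij: "i \<in> {s..<s + b}" "j \<in> {s..<s + b}" and "?g i = ?g j"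
    then have "int b dvd v * (int i - int j)"
      by (metis add_diff_cancel_left mod_eq_dvd_iff right_diff_distrib)
    then have "int b dvd int i - int j"
      using cop by (metis coprime_commute coprime_dvd_mult_right_iff)
    moreover have "\<bar>int i - int j\<bar> < int b" using ij by auto
    ultimately show "i = j"
      using dvd_imp_le_int[of "int i - int j" "int b"] by auto
  qed
  have "?g ` {s..<s + b} = {0..<int b}"
  proof (rule card_subset_eq)
    show "?g ` {s..<s + b} \<subseteq> {0..<int b}" using b by auto
    show "card (?g ` {s..<s + b}) = card {0..<int b}"
      by (simp add: card_image[OF inj])
  qed simp
  then have "(\<Sum>z = s..<s + b. real_of_int (?g z)) = (\<Sum>i\<in>{0..<int b}. real_of_int i)"
    using sum.reindex[OF inj, of real_of_int] by simp
  also have "\<dots> = (\<Sum>i\<in>int ` {0..<b}. real_of_int i)"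
    by (simp add: image_int_atLeastLessThan)
  also have "\<dots> = (\<Sum>i<b. real i)"
    by (subst sum.reindex) (auto simp: atLeast0LessThan)
  also have "\<dots> = real b * (real b - 1) / 2"
    by (induction b) (auto simp: field_simps)
  finally show ?thesis .
qed

text \<open>A full period has mean exactly (b - 1)/2, so dropping \<open>b\<close> terms leaves the
  deviation unchanged. At most b - 1 terms finally remain, each within (b - 1)/2 of the
  mean.\<close>

lemma sum_mod_deviation:
  fixes u v :: int and b Q :: nat
  assumes b: "b > 0" and cop: "coprime v (int b)"
  shows "\<bar>(\<Sum>z<Q. real_of_int ((u + v * int z) mod int b)) - real Q * (real b - 1) / 2\<bar>
           \<le> (real b - 1)\<^sup>2 / 2"
proof (induction Q rule: less_induct)
  case (less Q)
  let ?g = "\<lambda>z::nat. real_of_int ((u + v * int z) mod int b)"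
  show ?case
  proof (cases "Q < b")
    case True
    have dev: "\<bar>?g z - (real b - 1) / 2\<bar> \<le> (real b - 1) / 2" for z
    proof -
      have "0 \<le> (u + v * int z) mod int b" "(u + v * int z) mod int b \<le> int b - 1"
        using b by (simp_all add: zle_diff1_eq)
      then have "0 \<le> ?g z" "?g z \<le> real b - 1" by linarith+
      then show ?thesis by (simp add: abs_le_iff field_simps)
    qed
    have "\<bar>(\<Sum>z<Q. ?g z) - real Q * (real b - 1) / 2\<bar> = \<bar>\<Sum>z<Q. ?g z - (real b - 1) / 2\<bar>"
      by (simp add: sum_subtractf)
    also have "\<dots> \<le> (\<Sum>z<Q. (real b - 1) / 2)"
      by (rule order_trans[OF sum_abs sum_mono]) (rule dev)
    also have "\<dots> = real Q * ((real b - 1) / 2)" by simp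
    also have "\<dots> \<le> (real b - 1) * ((real b - 1) / 2)"
      using True by (intro mult_right_mono) auto
    finally show ?thesis by (simp add: power2_eq_square)
  next
    case False
    define P where "P = Q - b"
    have Q: "Q = P + b" "P < Q" using False b by (auto simp: P_def)
    have "{..<Q} = {..<P} \<union> {P..<P + b}" using Q by auto
    then have "(\<Sum>z<Q. ?g z) = (\<Sum>z<P. ?g z) + (\<Sum>z = P..<P + b. ?g z)"
      by (simp add: sum.union_disjoint ivl_disj_int)
    then have "(\<Sum>z<Q. ?g z) - real Q * (real b - 1) / 2 = (\<Sum>z<P. ?g z) - real P * (real b - 1) / 2"
      unfolding sum_mod_full_period[OF b cop] by (simp add: Q field_simps)
    then show ?thesis using less[OF Q(2)] by simp
  qed
qed

section \<open>Three variables\<close>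

lemma solutions_of_neg: "n < 0 \<Longrightarrow> solutions a b c n = {}"
  by (auto simp: solutions_def) (smt (verit) of_nat_0_le_iff mult_nonneg_nonneg)

text \<open>Slices the solution set by z; for z \<le> n div c the remaining right-hand side is
  nonnegative, as the two-variable count requires. Writing u (n - c z) as u n + (-u c) z exposes the
  arithmetic progression in z.\<close>

lemma card_solutions_eq_sum:
  assumes pos: "a > 0" "b > 0" "c > 0" and uv: "u * int a + v * int b = 1"
  shows "real (card (solutions a b c (int n))) =
      (\<Sum>z<n div c + 1. (real n - real c * real z) / (real a * real b) + 1
         - real_of_int ((u * int n + (- u * int c) * int z) mod int b) / real b
         - real_of_int ((v * int n + (- v * int c) * int z) mod int a) / real a)"
proof -
  let ?S = "\<lambda>z. {(x :: nat, y :: nat). int a * int x + int b * int y = int n - int c * int z}"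
  let ?A = "SIGMA z:{..<n div c + 1}. ?S z"
  have nonneg: "0 \<le> int n - int c * int z" if "z < n div c + 1" for z
  proof -
    have "z \<le> n div c" using that by simp
    then have "z * c \<le> n" using pos by (simp add: less_eq_div_iff_mult_less_eq)
    then have "int (z * c) \<le> int n" by (rule of_nat_mono)
    then show ?thesis by (simp add: mult.commute)
  qed
  have fin: "finite (?S z)" if "z < n div c + 1" for z
    using card_two_var_solutions(1)[OF pos(1,2) uv nonneg[OF that]] .
  have bij: "bij_betw (\<lambda>(z, x, y). (x, y, z)) ?A (solutions a b c (int n))"
  proof (rule bij_betw_byWitness[where f' = "\<lambda>(x, y, z). (z, x, y)"])
    show "(\<lambda>(x, y, z). (z, x, y)) ` solutions a b c (int n) \<subseteq> ?A"
    proof clarsimp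
      fix x y z assume "(x, y, z) \<in> solutions a b c (int n)"
      then have eq: "int a * int x + int b * int y + int c * int z = int n"
        by (simp add: solutions_def)
      then have "int (a * x + b * y + c * z) = int n" by simp
      then have "a * x + b * y + c * z = n" by (simp only: of_nat_eq_iff)
      then have "z * c \<le> n" by (auto simp: mult.commute)
      then have "z \<le> n div c" using pos by (simp add: less_eq_div_iff_mult_less_eq)
      with eq show "z < Suc (n div c) \<and> int a * int x + int b * int y = int n - int c * int z"
        by auto
    qed
  qed (auto simp: solutions_def)
  have "real (card (solutions a b c (int n))) = real (card ?A)"
    using bij_betw_same_card[OF bij] by simp
  also have "\<dots> = (\<Sum>z<n div c + 1. real (card (?S z)))"
    using fin by (subst card_SigmaI) auto
  also have "\<dots> = (\<Sum>z<n div c + 1. (real n - real c * real z) / (real a * real b) + 1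
         - real_of_int ((u * int n + (- u * int c) * int z) mod int b) / real b
         - real_of_int ((v * int n + (- v * int c) * int z) mod int a) / real a)"
  proof (rule sum.cong)
    fix z assume "z \<in> {..<n div c + 1}"
    then have "0 \<le> int n - int c * int z" using nonneg by simp
    from card_two_var_solutions(2)[OF pos(1,2) uv this]
    show "real (card (?S z)) = (real n - real c * real z) / (real a * real b) + 1
         - real_of_int ((u * int n + (- u * int c) * int z) mod int b) / real b
         - real_of_int ((v * int n + (- v * int c) * int z) mod int a) / real a"
      by (simp add: algebra_simps)
  qed simp
  finally show ?thesis .
qed

lemma card_solutions_near_quadratic:
  fixes a b c n :: nat
  assumes pos: "a > 0" "b > 0" "c > 0"
    and cop: "coprime a b" "coprime b c" "coprime c a"
  shows "\<bar>real (card (solutions a b c (int n)))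
           - real n * (real n + 2 * alpha a b c) / beta a b c\<bar> < alpha a b c"
proof -
  obtain u v where uv: "u * int a + v * int b = 1"
    using bezout_int[of "int a" "int b"] cop(1) by (auto simp: coprime_iff_gcd_eq_1)
  \<comment> \<open>The Bezout identity makes \<open>u\<close> prime to \<open>b\<close> and
    \<open>v\<close> prime to \<open>a\<close>; with \<open>c\<close> prime to both, the steps -u c
    and -v c are admissible for the deviation bound.\<close>
  have "coprime u (int b)"
  proof (rule coprimeI)
    fix d assume "d dvd u" "d dvd int b"
    then have "d dvd u * int a + v * int b" by simp
    then show "is_unit d" by (simp add: uv)
  qed
  then have cop_b: "coprime (- u * int c) (int b)"
    using cop(2) by (simp add: coprime_commute)
  have "coprime v (int a)"
  proof (rule coprimeI)
    fix d assume "d dvd v" "d dvd int a"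
    then have "d dvd u * int a + v * int b" by simp
    then show "is_unit d" by (simp add: uv)
  qed
  then have cop_a: "coprime (- v * int c) (int a)"
    using cop(3) by simp
  define q where "q = n div c"
  define r where "r = n mod c"
  have n: "real n = real c * real q + real r"
    by (metis mult_div_mod_eq of_nat_add of_nat_mult q_def r_def)
  have r: "real r < real c" using pos by (simp add: r_def)
  define eb where "eb = (\<Sum>z<q + 1. real_of_int ((u * int n + (- u * int c) * int z) mod int b))
      - real (q + 1) * (real b - 1) / 2"
  define ea where "ea = (\<Sum>z<q + 1. real_of_int ((v * int n + (- v * int c) * int z) mod int a))
      - real (q + 1) * (real a - 1) / 2"
  have eb: "\<bar>eb\<bar> \<le> (real b - 1)\<^sup>2 / 2"
    unfolding eb_def by (rule sum_mod_deviation[OF pos(2) cop_b])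
  have ea: "\<bar>ea\<bar> \<le> (real a - 1)\<^sup>2 / 2"
    unfolding ea_def by (rule sum_mod_deviation[OF pos(1) cop_a])
  define A B C where "A = real a" and "B = real b" and "C = real c"
  have ABC: "A \<ge> 1" "B \<ge> 1" "C \<ge> 1" using pos by (simp_all add: A_def B_def C_def)
  have gauss: "(\<Sum>z<q + 1. real z) = real q * real (q + 1) / 2"
    by (induction q) (auto simp: field_simps)
  have "real (card (solutions a b c (int n))) =
      real (q + 1) * real n / (A * B) - C * (\<Sum>z<q + 1. real z) / (A * B) + real (q + 1)
      - (eb + real (q + 1) * (B - 1) / 2) / B - (ea + real (q + 1) * (A - 1) / 2) / A"
    unfolding card_solutions_eq_sum[OF pos uv] q_def[symmetric] eb_def ea_def A_def B_def C_def
    by (simp only: sum.distrib sum_subtractf diff_divide_distrib sum_divide_distrib[symmetric]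
          sum_distrib_left[symmetric] sum_constant card_lessThan) simp
  \<comment> \<open>With n = C q + r, the terms other than \<open>ea\<close> and \<open>eb\<close>
    combine to (n - r + C)(n + r + A + B) / (2ABC). Subtracting the quadratic leaves a remainder
    depending on r only.\<close>
  also have "\<dots> - real n * (real n + (A + B + C)) / (2 * A * B * C) =
      (C - real r) * (real r + A + B) / (2 * A * B * C) - eb / B - ea / A"
    using ABC unfolding gauss n C_def[symmetric] by (simp add: field_simps)
  finally have E: "real (card (solutions a b c (int n)))
        - real n * (real n + (A + B + C)) / (2 * A * B * C) =
      (C - real r) * (real r + A + B) / (2 * A * B * C) - eb / B - ea / A" .
  have main_nonneg: "0 \<le> (C - real r) * (real r + A + B) / (2 * A * B * C)"
    using ABC r by (simp add: C_def)
  have "(C - real r) * (real r + A + B) \<le> C * (A + B) + C\<^sup>2 / 4"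
  proof -
    have "(C - real r) * real r \<le> C\<^sup>2 / 4"
      using zero_le_power2[of "C / 2 - real r"] by (simp add: power2_eq_square field_simps)
    moreover have "(C - real r) * (A + B) \<le> C * (A + B)"
      using ABC by (intro mult_right_mono) auto
    ultimately show ?thesis by (simp add: algebra_simps)
  qed
  then have "(C - real r) * (real r + A + B) / (2 * A * B * C) \<le> (C * (A + B) + C\<^sup>2 / 4) / (2 * A * B * C)"
    using ABC by (intro divide_right_mono) auto
  also have "\<dots> = 1 / (2 * A) + 1 / (2 * B) + C / 8 / (A * B)"
    using ABC by (simp add: field_simps power2_eq_square)
  also have "C / 8 / (A * B) \<le> C / 8 / 1"
    using ABC mult_mono[of 1 A 1 B] by (intro divide_left_mono) auto
  finally have main_le: "(C - real r) * (real r + A + B) / (2 * A * B * C)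
      \<le> 1 / (2 * A) + 1 / (2 * B) + C / 8" by simp
  \<comment> \<open>Since (x - 1)^2 + 1 \<le> x^2 for x \<ge> 1, each deviation bound has room for
    one of the terms 1/(2A), 1/(2B) of \<open>main_le\<close>.\<close>
  have err: "\<bar>e / x\<bar> + 1 / (2 * x) \<le> x / 2" if "\<bar>e\<bar> \<le> (x - 1)\<^sup>2 / 2" "x \<ge> 1" for e x :: real
  proof -
    have "\<bar>e / x\<bar> + 1 / (2 * x) = (\<bar>e\<bar> + 1 / 2) / x"
      using that by (simp add: abs_divide add_divide_distrib)
    also have "\<dots> \<le> (x * x / 2) / x"
      using that by (intro divide_right_mono) (auto simp: power2_eq_square algebra_simps)
    finally show ?thesis using that by simp
  qed
  \<comment> \<open>Strictness comes from C/8 < C/2.\<close>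
  have combine: "\<bar>d - x - y\<bar> < (A + B + C) / 2"
    if "0 \<le> d" "d \<le> p + s + C / 8" "\<bar>x\<bar> + s \<le> B / 2" "\<bar>y\<bar> + p \<le> A / 2"
    for d x y p s :: real
  proof -
    have "\<bar>d - x - y\<bar> \<le> \<bar>d - x\<bar> + \<bar>y\<bar>" "\<bar>d - x\<bar> \<le> \<bar>d\<bar> + \<bar>x\<bar>"
      by (rule abs_triangle_ineq4)+
    moreover have "\<bar>d\<bar> = d" using that(1) by simp
    ultimately have "\<bar>d - x - y\<bar> \<le> C / 8 + B / 2 + A / 2"
      using that(2-4) by linarith
    also have "\<dots> < (A + B + C) / 2"
      using ABC by (simp add: field_simps)
    finally show ?thesis .
  qed
  have "\<bar>(C - real r) * (real r + A + B) / (2 * A * B * C) - eb / B - ea / A\<bar> < (A + B + C) / 2"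
  proof (rule combine[OF main_nonneg main_le])
    show "\<bar>eb / B\<bar> + 1 / (2 * B) \<le> B / 2" "\<bar>ea / A\<bar> + 1 / (2 * A) \<le> A / 2"
      using err[of eb B] err[of ea A] ea eb ABC by (simp_all only: A_def B_def)
  qed
  moreover have "alpha a b c = (A + B + C) / 2" "2 * alpha a b c = A + B + C"
      "beta a b c = 2 * A * B * C"
    by (simp_all add: alpha_def beta_def A_def B_def C_def)
  ultimately show ?thesis
    using E by simp
qed

section \<open>Localization of the solutions\<close>

text \<open>Multiplying by \<open>be\<close> and adding al^2 completes the square (n + al)^2. If the
  lower radicand is negative, so is its \<open>sqrt\<close>, and the lower bound persists.\<close>

lemma localize_by_sqrt:
  fixes al be :: real and n k :: nat
  assumes al: "al > 0" and be: "be > 0"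
    and near: "\<bar>real k - real n * (real n + 2 * al) / be\<bar> < al"
  shows "sqrt (be * (real k - al) + al\<^sup>2) - al < real n"
    and "real n < sqrt (be * (real k + al) + al\<^sup>2) - al"
proof -
  have "real k - al < real n * (real n + 2 * al) / be" "real n * (real n + 2 * al) / be < real k + al"
    using near by linarith+
  then have "be * (real k - al) < real n * (real n + 2 * al)"
            "real n * (real n + 2 * al) < be * (real k + al)"
    using be by (simp_all add: field_simps)
  then have lo: "be * (real k - al) + al\<^sup>2 < (real n + al)\<^sup>2"
       and up: "(real n + al)\<^sup>2 < be * (real k + al) + al\<^sup>2"
    by (simp_all add: power2_eq_square algebra_simps)
  show "sqrt (be * (real k - al) + al\<^sup>2) - al < real n"
    using real_less_lsqrt[OF _ lo] al by simp
  show "real n < sqrt (be * (real k + al) + al\<^sup>2) - al"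
    using real_less_rsqrt[OF up] by simp
qed

text \<open>The radicands differ by 2 al be, so with X the smaller one the gap is below 1 once sqrt
  X > (2 al be - 1)/2. Squaring this and solving for \<open>k\<close> yields the threshold.\<close>

lemma sqrt_gap_less_one:
  fixes al be k :: real
  assumes al: "al > 0" and be: "be > 0"
    and k: "((2 * al * be - 1)\<^sup>2 - 4 * al\<^sup>2) / (4 * be) + al < k"
  shows "sqrt (be * (k + al) + al\<^sup>2) < sqrt (be * (k - al) + al\<^sup>2) + 1"
proof -
  define X where "X = be * (k - al) + al\<^sup>2"
  have "((2 * al * be - 1)\<^sup>2 - 4 * al\<^sup>2) / (4 * be) < k - al" using k by simp
  then have "(2 * al * be - 1)\<^sup>2 - 4 * al\<^sup>2 < 4 * be * (k - al)"
    using be by (simp add: pos_divide_less_eq mult_ac)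
  then have "((2 * al * be - 1) / 2)\<^sup>2 < X"
    by (simp add: X_def power_divide)
  then have X: "(2 * al * be - 1) / 2 < sqrt X" and "X > 0"
    by (rule real_less_rsqrt) (use \<open>((2 * al * be - 1) / 2)\<^sup>2 < X\<close> in \<open>smt (verit) zero_le_power2\<close>)
  have "be * (k + al) + al\<^sup>2 = X + 2 * al * be" by (simp add: X_def algebra_simps)
  also have "\<dots> < (sqrt X + 1)\<^sup>2"
    using X \<open>X > 0\<close> by (simp add: power2_sum)
  finally have "sqrt (be * (k + al) + al\<^sup>2) < sqrt X + 1"
    using \<open>X > 0\<close> by (intro real_less_lsqrt) auto
  then show ?thesis by (simp add: X_def)
qed

theorem theorem3:
  fixes a b c k :: nat
  assumes "a > 0" and "b > 0" and "c > 0"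
    and "gcd a b = 1" and "gcd b c = 1" and "gcd c a = 1"
    and "int k \<ge> bound_M a b c"
  shows "(gamma a b c k = delta a b c k \<longrightarrow> R k a b c = {}) \<and>
    (gamma a b c k \<noteq> delta a b c k \<longrightarrow>
      (has_exactly_solutions a b c (gamma a b c k) k \<longrightarrow> R k a b c = {gamma a b c k}) \<and>
      (\<not> has_exactly_solutions a b c (gamma a b c k) k \<longrightarrow> R k a b c = {}))"
proof -
  define al be where "al = alpha a b c" and "be = beta a b c"
  have al: "al \<ge> 1"
    using assms(1-3) by (simp add: al_def alpha_def)
  have "1 \<le> a * b * c" using assms(1-3) by (simp add: Suc_le_eq)
  then have "1 \<le> real (a * b * c)" by linarith
  then have be: "be \<ge> 2" by (simp add: be_def beta_def)
  define T where "T = ((2 * al * be - 1)\<^sup>2 - 4 * al\<^sup>2) / (4 * be) + al"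
  have "\<lfloor>T\<rfloor> + 1 \<le> int k"
    using assms(7) by (simp add: bound_M_def T_def al_def be_def)
  then have k: "T < real k" by linarith
  \<comment> \<open>Every negative n has exactly 0 solutions, so positivity of \<open>k\<close> is
    what restricts \<open>R k a b c\<close> to n \<ge> 0, where the estimate applies.\<close>
  have "k > 0"
  proof -
    have "al * 2 \<le> al * be" using al be by (intro mult_left_mono) auto
    then have "2 * al \<le> 2 * al * be - 1" using al by linarith
    then have "(2 * al)\<^sup>2 \<le> (2 * al * be - 1)\<^sup>2" using al by (intro power_mono) auto
    then have "0 < T" using al be by (simp add: T_def power_mult_distrib add_nonneg_pos)
    with k show ?thesis by simp
  qed
  define lo up where "lo = sqrt (be * (real k - al) + al\<^sup>2) - al"
    and "up = sqrt (be * (real k + al) + al\<^sup>2) - al"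
  have gap: "up < lo + 1"
    using sqrt_gap_less_one[of al be "real k"] k al be by (simp add: lo_def up_def T_def)
  have gamma: "gamma a b c k = \<lfloor>up\<rfloor>" and delta: "delta a b c k = \<lfloor>lo\<rfloor>"
    by (simp_all add: gamma_def delta_def lo_def up_def al_def be_def)
  have loc: "lo < real_of_int n \<and> real_of_int n < up" if "n \<in> R k a b c" for n
  proof -
    have card: "card (solutions a b c n) = k"
      using that by (simp add: R_def has_exactly_solutions_def)
    with \<open>k > 0\<close> solutions_of_neg[of n a b c] have "n \<ge> 0"
      by (cases "n < 0") auto
    then obtain m where m: "n = int m" using nonneg_int_cases by blast
    have "\<bar>real k - real m * (real m + 2 * al) / be\<bar> < al"
      using card_solutions_near_quadratic[of a b c m] assms(1-6) card
      by (simp add: m al_def be_def coprime_iff_gcd_eq_1)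
    from localize_by_sqrt[OF _ _ this] al be show ?thesis
      by (simp add: lo_def up_def m)
  qed
  have R_sub: "n = gamma a b c k \<and> gamma a b c k \<noteq> delta a b c k" if "n \<in> R k a b c" for n
  proof -
    \<comment> \<open>From lo < n < up < lo + 1 < n + 1: the upper end has floor n, while the floor
      of \<open>lo\<close> is smaller.\<close>
    have "n = \<lfloor>up\<rfloor>" "\<lfloor>lo\<rfloor> < n"
      using loc[OF that] gap by linarith+
    then show ?thesis by (simp add: gamma delta)
  qed
  have R_iff: "n \<in> R k a b c \<longleftrightarrow> has_exactly_solutions a b c n k" for n
    by (simp add: R_def)
  show ?thesis
    using R_sub R_iff by blast
qed

end
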